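(* In the $GL_q(N)$ differential algebra generated by the entries of the $N\times N$ matrices $T$, $\omega$, $L$, $J$ with the relations given in the context, the element $$Q=\mathrm{Tr}_q\Big(\omega\,\frac{L-\mathbf 1}{\lambda}-\omega\,L\,(\omega J)\,(\mathbf 1+\lambda\,\omega J)^{-1}\Big)=-\frac1\lambda\mathrm{Tr}_q(\omega)+\frac1\lambda\mathrm{Tr}_q\big(\omega\,L\,(\mathbf 1+\lambda\,\omega J)^{-1}\big)$$ (the BRST operator for $U_q(gl(N))$) satisfies $$Q^2=0,\qquad [Q,L]=0,\qquad [Q,T]=T\,\omega\equiv dT,\qquad [Q,\omega]_+=-\omega^2\equiv d\omega,\qquad [Q,J]_+=\frac1\lambda(\mathbf 1-L).$$ Here $[Q,Y]$ and $[Q,Y]_+$ for a matrix $Y$ denote the matrices of entrywise commutators and anticommutators, and $T\omega$, $\omega^2$ are matrix products.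
   Context: Notation. $q$ is the deformation parameter, $\lambda=q-q^{-1}\ne0$. $\hat R=P_{12}R_{12}$, where $P_{12}$ is the permutation matrix on $\mathbb C^N\otimes\mathbb C^N$ and $R_{12}$ is the $GL_q(N)$ Drinfeld–Jimbo matrix $$R^{i_1i_2}_{j_1j_2}=\delta^{i_1}_{j_1}\delta^{i_2}_{j_2}\big(1+(q-1)\delta^{i_1i_2}\big)+(q-q^{-1})\delta^{i_1}_{j_2}\delta^{i_2}_{j_1}\Theta_{i_1i_2},$$ with $\Theta_{ij}=1$ for $i>j$ and $0$ for $i\le j$; it satisfies $\hat R^2=\lambda\hat R+\mathbf 1$. For an $N\times N$ matrix $Y$ (possibly with noncommuting entries), $Y_1=Y\otimes\mathbf 1$, $Y_2=\mathbf 1\otimes Y$, and the quantum trace is $\mathrm{Tr}_q(Y)=\mathrm{Tr}(D^{-1}Y)$ with $(D^{-1})^i_j=q^{2(N-i)+1}\delta^i_j$. The $GL_q(N)$ differential algebra is the associative unital algebra generated by the entries of the $N\times N$ matrices $T$ (generators of $Fun(GL_q(N))$), $\omega$ (1-forms), $L$ (invertible; $L$ is built from the generators of $U_q(gl(N))$ by $L^i_j=(L^+)^i_kS((L^-)^k_j)$) and $J$ (inner derivatives), with relations $$\omega_2\hat R^{-1}\omega_2\hat R=-\hat R^{-1}\omega_2\hat R^{-1}\omega_2,\quad \omega_2\hat RL_2\hat R=\hat RL_2\hat R\omega_2,$$ $$\omega_2\hat RJ_2\hat R+\hat RJ_2\hat R\omega_2=-\hat R,\quad L_2\hat RL_2\hat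 R=\hat RL_2\hat RL_2,$$ $$J_2\hat RL_2\hat R=\hat RL_2\hat RJ_2,\quad J_2\hat RJ_2\hat R=-\hat R^{-1}J_2\hat RJ_2,$$ $$\hat RT_1T_2=T_1T_2\hat R,\quad \omega_1T_2=T_2\hat R^{-1}\omega_2\hat R^{-1},\quad J_1T_2=T_2\hat RJ_2\hat R,\quad L_1T_2=T_2\hat RL_2\hat R.$$ The matrix $\mathbf 1+\lambda\,\omega J$ is understood to be invertible, with inverse $(\mathbf 1+\lambda\omega J)^{-1}$. The (anti)commutator with $Q$ defines the exterior differential $d$ on the subalgebra generated by $T^i_j$ and $\omega^i_j$.
   Formalization: Q²=0 is stated only for q²≠−1 (q+1/q≠0): with only λ≠0 it fails, e.g. for N=1, q=i, where the relations leave ω² and J² free and Q² can be nonzero. All other identities are stated without this condition. *)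

theory Defs
  imports "HOL-Analysis.Analysis"
begin

text \<open>
  Associative unital algebras over the complex numbers, in analogy with the class
  \<open>real_algebra_1\<close> of the library.
\<close>

class complex_algebra_1 = ring_1 +
  fixes scaleC :: "complex \<Rightarrow> 'a \<Rightarrow> 'a" (infixr \<open>*\<^sub>C\<close> 75)
  assumes scaleC_add_right: "c *\<^sub>C (x + y) = c *\<^sub>C x + c *\<^sub>C y"
    and scaleC_add_left: "(c + d) *\<^sub>C x = c *\<^sub>C x + d *\<^sub>C x"
    and scaleC_scaleC: "c *\<^sub>C d *\<^sub>C x = (c * d) *\<^sub>C x"
    and scaleC_one: "1 *\<^sub>C x = x"
    and mult_scaleC_left: "c *\<^sub>C x * y = c *\<^sub>C (x * y)"
    and mult_scaleC_right: "x * c *\<^sub>C y = c *\<^sub>C (x * y)"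

type_synonym ('a, 'n) sqmat = "(('a, 'n) vec, 'n) vec"

definition mscale :: "complex \<Rightarrow> 'a::complex_algebra_1^'n^'m \<Rightarrow> 'a^'n^'m"
  where "mscale c M = (\<chi> i j. c *\<^sub>C (M $ i $ j))"

definition num_mat :: "complex^'n^'m \<Rightarrow> 'a::complex_algebra_1^'n^'m"
  where "num_mat M = (\<chi> i j. (M $ i $ j) *\<^sub>C 1)"

text \<open>
  The index set \<open>{1..N}\<close> is a finite linearly ordered type \<open>'n\<close> with \<open>N = CARD('n)\<close>; the
  number of an index is its position in the order.  Upper indices are row indices, lower
  indices are column indices, and operators on the tensor square have pairs as indices.
\<close>

definition pos :: "'n::{finite,linorder} \<Rightarrow> nat"
  where "pos i = card {k. k \<le> i}"

definition delta :: "'n \<Rightarrow> 'n \<Rightarrow> complex"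
  where "delta i j = (if i = j then 1 else 0)"

definition Theta :: "'n::linorder \<Rightarrow> 'n \<Rightarrow> complex"
  where "Theta i j = (if i > j then 1 else 0)"

definition lam :: "complex \<Rightarrow> complex"
  where "lam q = q - inverse q"

definition R_mat :: "complex \<Rightarrow> (complex, 'n::{finite,linorder} \<times> 'n) sqmat"
  where "R_mat q = (\<chi> i j. case (i, j) of ((i1, i2), (j1, j2)) \<Rightarrow>
    delta i1 j1 * delta i2 j2 * (1 + (q - 1) * delta i1 i2)
    + (q - inverse q) * delta i1 j2 * delta i2 j1 * Theta i1 i2)"

definition P_mat :: "(complex, 'n::finite \<times> 'n) sqmat"
  where "P_mat = (\<chi> i j. case (i, j) of ((i1, i2), (j1, j2)) \<Rightarrow> delta i1 j2 * delta i2 j1)"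

definition Rhat_mat :: "complex \<Rightarrow> (complex, 'n::{finite,linorder} \<times> 'n) sqmat"
  where "Rhat_mat q = P_mat ** R_mat q"

definition Rhat :: "complex \<Rightarrow> ('a::complex_algebra_1, 'n::{finite,linorder} \<times> 'n) sqmat"
  where "Rhat q = num_mat (Rhat_mat q)"

definition Rhat_inv :: "complex \<Rightarrow> ('a::complex_algebra_1, 'n::{finite,linorder} \<times> 'n) sqmat"
  where "Rhat_inv q = num_mat (matrix_inv (Rhat_mat q))"

text \<open>The embeddings \<open>Y \<otimes> 1\<close> and \<open>1 \<otimes> Y\<close>.\<close>

definition leg1 :: "('a::ring_1, 'n::finite) sqmat \<Rightarrow> ('a, 'n \<times> 'n) sqmat"
  where "leg1 Y = (\<chi> i j. case (i, j) of ((i1, i2), (j1, j2)) \<Rightarrow>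
    if i2 = j2 then Y $ i1 $ j1 else 0)"

definition leg2 :: "('a::ring_1, 'n::finite) sqmat \<Rightarrow> ('a, 'n \<times> 'n) sqmat"
  where "leg2 Y = (\<chi> i j. case (i, j) of ((i1, i2), (j1, j2)) \<Rightarrow>
    if i1 = j1 then Y $ i2 $ j2 else 0)"

definition D_inv :: "complex \<Rightarrow> (complex, 'n::{finite,linorder}) sqmat"
  where "D_inv q = (\<chi> i j. q ^ (2 * (CARD('n) - pos i) + 1) * delta i j)"

definition Tr_q :: "complex \<Rightarrow> ('a::complex_algebra_1, 'n::{finite,linorder}) sqmat \<Rightarrow> 'a"
  where "Tr_q q Y = trace (num_mat (D_inv q) ** Y)"

definition K_mat ::
  "complex \<Rightarrow> ('a::complex_algebra_1, 'n::finite) sqmat \<Rightarrow> ('a, 'n) sqmat \<Rightarrow> ('a, 'n) sqmat"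
  where "K_mat q \<omega> J = mat 1 + mscale (lam q) (\<omega> ** J)"

text \<open>
  A complex algebra containing matrices that satisfy the defining relations.  The algebra
  presented by these generators and relations is the universal instance; no generation
  hypothesis is imposed, so results hold in every algebra in which the relations hold.
\<close>

locale glq_differential_algebra =
  fixes q :: complex
    and T \<omega> L J :: "('a::complex_algebra_1, 'n::{finite,linorder}) sqmat"
  assumes q_nonzero: "q \<noteq> 0"
    and lam_nonzero: "lam q \<noteq> 0"
    and L_invertible: "invertible L"
    and K_invertible: "invertible (K_mat q \<omega> J)"
    and omega_omega:
      "leg2 \<omega> ** Rhat_inv q ** leg2 \<omega> ** Rhat q
        = - (Rhat_inv q ** leg2 \<omega> ** Rhat_inv q ** leg2 \<omega>)"
    and omega_L:
      "leg2 \<omega> ** Rhat q ** leg2 L ** Rhat q = Rhat q ** leg2 L ** Rhat q ** leg2 \<omega>"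
    and omega_J:
      "leg2 \<omega> ** Rhat q ** leg2 J ** Rhat q + Rhat q ** leg2 J ** Rhat q ** leg2 \<omega>
        = - Rhat q"
    and L_L:
      "leg2 L ** Rhat q ** leg2 L ** Rhat q = Rhat q ** leg2 L ** Rhat q ** leg2 L"
    and J_L:
      "leg2 J ** Rhat q ** leg2 L ** Rhat q = Rhat q ** leg2 L ** Rhat q ** leg2 J"
    and J_J:
      "leg2 J ** Rhat q ** leg2 J ** Rhat q
        = - (Rhat_inv q ** leg2 J ** Rhat q ** leg2 J)"
    and T_T: "Rhat q ** leg1 T ** leg2 T = leg1 T ** leg2 T ** Rhat q"
    and omega_T: "leg1 \<omega> ** leg2 T = leg2 T ** Rhat_inv q ** leg2 \<omega> ** Rhat_inv q"
    and J_T: "leg1 J ** leg2 T = leg2 T ** Rhat q ** leg2 J ** Rhat q"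
    and L_T: "leg1 L ** leg2 T = leg2 T ** Rhat q ** leg2 L ** Rhat q"

definition BRST ::
  "complex \<Rightarrow> ('a::complex_algebra_1, 'n::{finite,linorder}) sqmat \<Rightarrow> ('a, 'n) sqmat \<Rightarrow> ('a, 'n) sqmat \<Rightarrow> 'a"
  where "BRST q \<omega> L J = Tr_q q
    (\<omega> ** mscale (1 / lam q) (L - mat 1)
      - \<omega> ** L ** (\<omega> ** J) ** matrix_inv (K_mat q \<omega> J))"

text \<open>
  On top of \<open>lam q \<noteq> 0\<close>, nilpotency of \<open>BRST\<close> needs \<open>q + 1/q \<noteq> 0\<close>: the relation for \<open>\<omega>\<close> gives
  \<open>(q + 1/q)^2 * Tr_q (\<omega>^2) = 0\<close>, but nothing on \<open>Tr_q (\<omega>^2)\<close> when \<open>q^2 = -1\<close>.  For \<open>N = 1\<close>,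
  \<open>q = \<i>\<close>, \<open>L = 1\<close>, \<open>T = 0\<close> and \<open>\<omega>^2 = J^2 = 1\<close>, \<open>\<omega> J + J \<omega> = \<i>\<close> (a Clifford algebra) the relations hold,
  while the square of \<open>BRST\<close> is a nonzero scalar.
\<close>

definition comm :: "'a::ring_1 \<Rightarrow> 'a^'n^'m \<Rightarrow> 'a^'n^'m"
  where "comm x Y = (\<chi> i j. x * Y $ i $ j - Y $ i $ j * x)"

definition anticomm :: "'a::ring_1 \<Rightarrow> 'a^'n^'m \<Rightarrow> 'a^'n^'m"
  where "anticomm x Y = (\<chi> i j. x * Y $ i $ j + Y $ i $ j * x)"

end

theory Submission
  imports Defs
begin

text \<open>
  Write \<open>R\<close> for the braid matrix, \<open>X\<close> for \<open>leg2 X\<close>, \<open>K = 1 + \<lambda> \<omega> J\<close> and \<open>S = \<omega> L K\<inverse>\<close>, so that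
  \<open>\<lambda> Q = Tr_q S - Tr_q \<omega>\<close>.  The defining relations imply exchange relations between \<open>S\<close> and each
  generator in which \<open>S\<close> enters as \<open>R S R\<inverse>\<close> or \<open>R\<inverse> S R\<close>.  The quantum trace over the first tensor
  factor sends both expressions to the scalar matrix \<open>Tr_q S\<close> and sends \<open>R\<inverse>\<close> to \<open>1\<close>, so the exchange
  relations become (anti)commutators with \<open>Tr_q S\<close>, and likewise for \<open>\<omega>\<close>.

  Both \<open>X = \<omega>\<close> and \<open>X = S\<close> satisfy \<open>X R\<inverse> X = - R X R\<inverse> X R\<close>.  Tracing this relation over one and over
  both factors gives \<open>2 x\<^sup>2 = \<lambda> t\<close> and \<open>2 t = - \<lambda> x\<^sup>2\<close> for \<open>x = Tr_q X\<close> and \<open>t = Tr_q (X\<^sup>2)\<close>, hence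
  \<open>(q + q\<inverse>)\<^sup>2 x\<^sup>2 = 0\<close>; as \<open>Tr_q \<omega>\<close> and \<open>Tr_q S\<close> anticommute, \<open>Q\<^sup>2 = 0\<close> follows.
\<close>

section \<open>Exchange relations\<close>

text \<open>An abstract ring stands for the matrices over the algebra, so that ring simplification
  applies. Primes mark inverses, \<open>w\<close> is \<omega>, and the central element
  \<open>c\<close> plays the role of \<lambda>; \<open>R_eq\<close> is the Hecke condition.\<close>

locale hecke_reflection =
  fixes R R' c w L J K K' :: "'b::ring_1"
  assumes R_R': "R * R' = 1"
    and R'_R: "R' * R = 1"
    and R_eq: "R = R' + c"
    and central: "\<And>x. x * c = c * x"
    and K_eq: "K = 1 + c * (w * J)"
    and K_K': "K * K' = 1"
    and K'_K: "K' * K = 1"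
    and w_w: "w * R' * w * R = - (R' * w * R' * w)"
    and w_L: "w * R * L * R = R * L * R * w"
    and w_J: "w * R * J * R + R * J * R * w = - R"
    and L_L: "L * R * L * R = R * L * R * L"
    and J_L: "J * R * L * R = R * L * R * J"
    and J_J: "J * R * J * R = - (R' * J * R * J)"
begin

abbreviation S :: 'b
  where "S \<equiv> w * L * K'"

lemma cancel:
  "R * (R' * x) = x" "R' * (R * x) = x" "K * (K' * x) = x" "K' * (K * x) = x"
  by (simp_all add: mult.assoc[symmetric] R_R' R'_R K_K' K'_K)

lemmas inv_simps = R_R' R'_R K_K' K'_K cancel

lemma central_left:
  "R * (c * x) = c * (R * x)" "R' * (c * x) = c * (R' * x)" "w * (c * x) = c * (w * x)"
  "J * (c * x) = c * (J * x)" "L * (c * x) = c * (L * x)"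
  by (simp_all add: mult.assoc[symmetric] central)

lemma R'_eq: "R' = R - c"
  by (simp add: R_eq)

lemma mult_R_left: "R * x = R' * x + c * x"
  by (simp add: R_eq distrib_right)

lemma w_w': "w * R' * w = - (R' * w * R' * w * R')"
proof -
  have "w * R' * w = (w * R' * w * R) * R'"
    by (simp add: mult.assoc inv_simps)
  then show ?thesis
    by (simp add: w_w)
qed

section \<open>Exchange relations of \<open>K\<close> with \<open>L\<close>, \<open>w\<close>,
  \<open>J\<close> and itself\<close>

lemma K_L: "K * R * L * R = R * L * R * K"
proof -
  have "w * J * (R * L * R) = w * (R * L * R * J)"
    using J_L by (simp add: mult.assoc)
  also have "\<dots> = (R * L * R) * (w * J)"
    using w_L by (simp add: mult.assoc[symmetric])
  finally have "w * J * (R * L * R) = (R * L * R) * (w * J)" .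
  then have "c * (w * J) * (R * L * R) = (R * L * R) * (c * (w * J))"
    by (simp add: mult.assoc central_left)
  then show ?thesis
    by (simp add: K_eq distrib_left distrib_right mult.assoc)
qed

lemma K_R_L: "K * R * L = R * L * R * K * R'"
proof -
  have "K * R * L = K * R * L * R * R'" by (simp add: mult.assoc inv_simps)
  then show ?thesis by (simp add: K_L)
qed

lemma K_w: "R * K * R * w = w * R' * K * R"
proof -
  have "R * K * R * w = R * R * w + c * (R * w * R' * (R * J * R * w))"
    by (simp add: K_eq distrib_left distrib_right mult.assoc inv_simps central_left)
  also have "R * J * R * w = - R - w * R * J * R"
    using w_J by (metis add_diff_cancel_left')
  also have "c * (R * w * R' * (- R - w * R * J * R)) =
      - (c * (R * w)) - c * (R * (w * R' * w) * R * J * R)"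
    by (simp add: right_diff_distrib mult.assoc inv_simps)
  also have "R * (w * R' * w) * R * J * R = - (w * R' * w * J * R)"
    by (subst w_w') (simp add: mult.assoc inv_simps)
  also have "R * R * w + (- (c * (R * w)) - c * - (w * R' * w * J * R)) =
      w + c * (w * R' * w * J * R)"
    by (simp add: mult_R_left[of "R * w"] mult.assoc inv_simps)
  also have "\<dots> = w * R' * K * R"
    by (simp add: K_eq distrib_left distrib_right mult.assoc inv_simps central_left)
  finally show ?thesis .
qed

text \<open>Reordering produces corrections with a factor \<open>c\<close>. They combine to
  \<open>c * (K * R * J)\<close>, which turns the last \<open>R\<close> of
  \<open>K * R * J * R\<close> into \<open>R'\<close>.\<close>

lemma K_J: "K * R * J * R' = R * J * R * K"
proof -
  have "w * J * (R * J * R) = - (w * R' * J * R * J)"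
    using J_J by (simp add: mult.assoc)
  also have "\<dots> = - (w * R * J * R * J) + c * (w * J * R * J)"
    by (simp add: R'_eq algebra_simps central_left central)
  also have "w * R * J * R = - R - R * J * R * w"
    using w_J by (metis add_diff_cancel_right')
  finally have "w * J * (R * J * R) = R * J + R * J * R * w * J + c * (w * J * R * J)"
    by (simp add: algebra_simps)
  then have "c * (w * J * (R * J * R)) =
      c * (R * J) + R * J * R * (c * (w * J)) + c * (c * (w * J) * R * J)"
    by (simp add: algebra_simps central_left)
  then have "K * (R * J * R) = R * J * R * K + c * (K * R * J)"
    by (simp add: K_eq algebra_simps)
  then show ?thesis
    by (simp add: R'_eq algebra_simps central)
qed

text \<open>\<open>K_J\<close> and \<open>K_w\<close> together carry \<open>w * J\<close> through
  \<open>R * K * R\<close>, and \<open>K\<close> is 1 plus a central multiple of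
  \<open>w * J\<close>.\<close>

lemma K_K: "K * R * K * R = R * K * R * K"
proof -
  have "J * R * K * R = R' * (R * J * R * K) * R"
    by (simp add: mult.assoc inv_simps)
  also have "\<dots> = R' * K * R * J"
    by (subst K_J[symmetric]) (simp add: mult.assoc inv_simps)
  finally have "w * J * R * K * R = w * R' * K * R * J"
    by (simp add: mult.assoc)
  also have "\<dots> = R * K * R * (w * J)"
    by (subst K_w[symmetric]) (simp add: mult.assoc)
  finally have "c * (w * J * R * K * R) = c * (R * K * R * (w * J))" by simp
  then have "(c * (w * J)) * (R * K * R) = (R * K * R) * (c * (w * J))"
    by (metis mult.assoc central)
  then have "K * (R * K * R) = (R * K * R) * K"
    by (subst (1 4) K_eq) (simp add: distrib_left distrib_right)
  then show ?thesis by (simp add: mult.assoc)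
qed

text \<open>By \<open>K_K\<close> the identity holds with \<open>R\<close> in place of the
  \<open>R'\<close> between \<open>K\<close> and \<open>K'\<close> on either side; passing from
  \<open>R\<close> to \<open>R - c\<close> subtracts \<open>c\<close> from both sides.\<close>

lemma K_conj: "R * K * R' * K' * R' = K' * R' * K"
proof -
  have "K' * R * K = K' * (R * K * R * K) * K' * R'"
    by (simp add: mult.assoc inv_simps)
  also have "\<dots> = R * K * R * K' * R'"
    by (subst K_K[symmetric]) (simp add: mult.assoc inv_simps)
  finally have "K' * R * K = R * K * R * K' * R'" .
  moreover have "K' * (c * K) = c * 1" "R * K * (c * (K' * R')) = c * 1"
    by (metis central mult.assoc inv_simps(4) mult_1_right,
        metis central mult.assoc inv_simps(1,7) mult_1_right)
  ultimately show ?thesis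
    by (simp add: R'_eq[of] algebra_simps)
qed

section \<open>Relations for \<open>w\<close> and \<open>S\<close> in the form to be traced\<close>

lemma w_L_conj: "R' * w * R * L = L * R * w * R'"
proof -
  have "R' * w * R * L = R' * (w * R * L * R) * R'" by (simp add: mult.assoc inv_simps)
  then show ?thesis unfolding w_L by (simp add: mult.assoc inv_simps)
qed

lemma w_w_conj: "R * w * R' * w = - (w * R' * w * R')"
proof -
  have "R * w * R' * w = R * (w * R' * w)" by (simp add: mult.assoc)
  then show ?thesis by (subst (asm) w_w') (simp add: mult.assoc inv_simps)
qed

text \<open>Flanking \<open>w_J\<close> by \<open>R'\<close> leaves \<open>w\<close> only in the
  conjugations by \<open>R\<close> and \<open>R'\<close>, whose partial trace is scalar.\<close>

lemma w_J_conj: "R' * w * R * J + J * R * w * R' = - R'"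
proof -
  have "R' * w * R * J + J * R * w * R' = R' * (w * R * J * R + R * J * R * w) * R'"
    by (simp add: mult.assoc inv_simps distrib_left distrib_right)
  then show ?thesis by (simp add: w_J inv_simps)
qed

text \<open>Each of the factors \<open>w\<close>, \<open>L\<close> and \<open>K'\<close> commutes
  with \<open>R * L * R\<close>.\<close>

lemma S_RLR: "S * R * L * R = R * L * R * S"
proof -
  have "K' * (R * L * R) = K' * (R * L * R * K) * K'" by (simp add: mult.assoc inv_simps)
  also have "\<dots> = R * L * R * K'" by (subst K_L[symmetric]) (simp add: mult.assoc inv_simps)
  finally have K': "K' * (R * L * R) = R * L * R * K'" .
  have "S * R * L * R = w * L * (K' * (R * L * R))" by (simp add: mult.assoc)
  also have "\<dots> = w * (L * R * L * R) * K'" by (simp only: K') (simp add: mult.assoc)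
  also have "\<dots> = (w * R * L * R) * L * K'" unfolding L_L by (simp add: mult.assoc)
  also have "\<dots> = R * L * R * S" unfolding w_L by (simp add: mult.assoc)
  finally show ?thesis .
qed

lemma S_L_conj: "R' * S * R * L = L * R * S * R'"
proof -
  have "R' * S * R * L = R' * (S * R * L * R) * R'" by (simp add: mult.assoc inv_simps)
  then show ?thesis by (simp add: S_RLR) (simp add: mult.assoc inv_simps)
qed

lemma w_wL: "w * R' * (w * L) * R = - (R * (w * L) * R * w)"
proof -
  have "R' * w * L * R * w = R' * w * R' * (R * L * R * w)" by (simp add: mult.assoc inv_simps)
  also have "\<dots> = (R' * w * R' * w) * R * L * R"
    by (subst w_L[symmetric]) (simp add: mult.assoc)
  also have "R' * w * R' * w = - (w * R' * w * R)" by (simp add: w_w)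
  finally have "R' * w * L * R * w = - (w * R' * w * R * R * L * R)" by simp
  then have "R * (R * (R' * w * L * R * w)) = - (R * (R * (w * R' * w * R) * R * L * R))"
    by (simp add: mult.assoc)
  also have "w * R' * w * R = - (R' * w * R' * w)" by (rule w_w)
  also have "R * (R * - (R' * w * R' * w) * R * L * R) = - (R * (w * R' * w) * R * L * R)"
    by (simp add: mult.assoc inv_simps)
  also have "w * R' * w = - (R' * w * R' * w * R')" by (rule w_w')
  also have "- (- (R * - (R' * w * R' * w * R') * R * L * R)) = - (w * R' * (w * L) * R)"
    by (simp add: mult.assoc inv_simps)
  finally show ?thesis by (simp add: mult.assoc inv_simps)
qed

text \<open>Inverting \<open>K_w\<close> shows how \<open>K'\<close> passes \<open>w\<close>; what
  remains is the reordering of \<open>w\<close> and \<open>w * L\<close> in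
  \<open>w_wL\<close>.\<close>

lemma w_S_conj: "w * R' * S * R = - (R * S * R' * w)"
proof -
  have "K' * R' * w = K' * R' * (w * R' * K * R) * R' * K' * R"
    by (simp add: mult.assoc inv_simps)
  also have "\<dots> = R * w * R' * K' * R"
    by (subst K_w[symmetric]) (simp add: mult.assoc inv_simps)
  finally have K': "K' * R' * w = R * w * R' * K' * R" .
  have "R * S * R' * w = R * w * L * (K' * R' * w)" by (simp add: mult.assoc)
  also have "\<dots> = R * (w * L) * R * w * R' * K' * R" by (simp add: K') (simp add: mult.assoc)
  also have "R * (w * L) * R * w = - (w * R' * (w * L) * R)" by (simp add: w_wL)
  also have "- (w * R' * (w * L) * R) * R' * K' * R = - (w * R' * S * R)"
    by (simp add: mult.assoc inv_simps)
  finally show ?thesis by simp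
qed

text \<open>\<open>K_conj\<close> brings the right-hand side to a form with a single
  \<open>R'\<close>, between \<open>K'\<close> and \<open>K\<close>: the partial trace sends it to
  1, \<open>K'\<close> and \<open>K\<close> cancel, and -L is left.\<close>

lemma S_J_conj: "R' * S * R * J + J * R * S * R' = - (L * K' * R' * K)"
proof -
  have "K' * (R * J * R) = K' * (R * J * R * K) * K'" by (simp add: mult.assoc inv_simps)
  also have "\<dots> = R * J * R' * K'" by (subst K_J[symmetric]) (simp add: mult.assoc inv_simps)
  finally have K': "K' * (R * J * R) = R * J * R' * K'" .
  have "R' * (J * R * L * R) * R' = R' * (R * L * R * J) * R'" by (simp add: J_L)
  then have LJ: "L * R * J * R' = R' * J * R * L" by (simp add: mult.assoc inv_simps)
  have "S * R * J * R = w * L * (K' * (R * J * R))" by (simp add: mult.assoc)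
  also have "\<dots> = w * (L * R * J * R') * K'" by (simp add: K') (simp add: mult.assoc)
  also have "\<dots> = (w * R' * J * R) * L * K'" unfolding LJ by (simp add: mult.assoc)
  also have "w * R' * J * R = w * R * J * R - c * (w * J * R)"
    by (simp add: R'_eq algebra_simps central_left)
  also have "w * R * J * R = - R - R * J * R * w" using w_J by (metis add_diff_cancel_right')
  also have "(- R - R * J * R * w - c * (w * J * R)) * L * K' = - (K * R * L) * K' - R * J * R * S"
    by (simp add: K_eq algebra_simps)
  finally have "S * R * J * R + R * J * R * S = - (R * L * R * K * R' * K')"
    by (simp add: K_R_L)
  then have "R' * (S * R * J * R + R * J * R * S) * R' = - (L * (R * K * R' * K' * R'))"
    by (simp add: mult.assoc inv_simps)
  then show ?thesis
    by (simp add: K_conj) (simp add: mult.assoc inv_simps distrib_left distrib_right)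
qed

text \<open>\<open>K'\<close> and then \<open>L\<close> are moved past the second \<open>S\<close>,
  after which \<open>w_S_conj\<close> exchanges it with the remaining \<open>w\<close>.\<close>

lemma S_S: "S * R' * S = - (R * S * R' * S * R)"
proof -
  have "R * K * R * S = w * R' * (K * R * L) * K'"
    using K_w by (simp add: mult.assoc[symmetric])
  also have "\<dots> = w * L * (R * K * R' * K' * R') * R"
    by (simp add: K_R_L) (simp add: mult.assoc inv_simps)
  also have "\<dots> = S * R' * K * R" unfolding K_conj by (simp add: mult.assoc inv_simps)
  finally have K_S: "R * K * R * S = S * R' * K * R" .
  have "K' * R' * S = K' * R' * (S * R' * K * R) * R' * K' * R"
    by (simp add: mult.assoc inv_simps)
  also have "\<dots> = R * S * R' * K' * R"
    by (subst K_S[symmetric]) (simp add: mult.assoc inv_simps)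
  finally have K': "K' * R' * S = R * S * R' * K' * R" .
  have "S * R' * S = w * L * (K' * R' * S)" by (simp add: mult.assoc)
  also have "\<dots> = w * (L * R * S * R') * K' * R" unfolding K' by (simp add: mult.assoc)
  also have "\<dots> = (w * R' * S * R) * L * K' * R"
    by (subst S_L_conj[symmetric]) (simp add: mult.assoc)
  also have "\<dots> = - (R * S * R' * S * R)" by (simp only: w_S_conj) (simp add: mult.assoc)
  finally show ?thesis .
qed

text \<open>Here \<open>w1\<close>, \<open>L1\<close>, \<open>J1\<close>, \<open>K1\<close> are
  copies in the first tensor factor and \<open>t\<close> is T in the second. \<open>S\<close>
  emerges between \<open>R'\<close> and \<open>R\<close>, while \<open>w\<close> emerges between two
  copies of \<open>R'\<close>; this difference decides which of the two traces commutes with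
  T.\<close>

lemma S_intertwine:
  assumes w: "w1 * t = t * R' * w * R'"
    and J: "J1 * t = t * R * J * R"
    and L: "L1 * t = t * R * L * R"
    and K1: "K1 = 1 + c * (w1 * J1)" "K1' * K1 = 1"
  shows "w1 * L1 * K1' * t = t * R' * S * R"
proof -
  have "w1 * J1 * t = w1 * t * R * J * R"
    by (simp add: J mult.assoc)
  also have "\<dots> = t * R' * w * J * R"
    unfolding w by (simp add: mult.assoc inv_simps)
  finally have wJ: "c * (w1 * J1 * t) = c * (t * R' * w * J * R)" by simp
  have "K1 * t = t + c * (t * R' * w * J * R)"
    using wJ by (simp add: K1(1) distrib_right mult.assoc)
  also have "\<dots> = t * R' * K * R"
  proof -
    have "t * (c * x) = c * (t * x)" for x by (metis central mult.assoc)
    then show ?thesis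
      by (simp add: K_eq distrib_left distrib_right mult.assoc inv_simps central_left)
  qed
  finally have K1_t: "K1 * t = t * R' * K * R" .
  have "K1' * t = K1' * (t * R' * K * R) * R' * K' * R"
    by (simp add: mult.assoc inv_simps)
  also have "\<dots> = (K1' * K1) * t * R' * K' * R"
    unfolding K1_t[symmetric] by (simp add: mult.assoc)
  finally have K1': "K1' * t = t * R' * K' * R" by (simp add: K1(2))
  have "w1 * L1 * K1' * t = w1 * (L1 * t) * R' * K' * R"
    by (simp add: K1' mult.assoc)
  also have "\<dots> = (w1 * t) * R * L * K' * R"
    unfolding L by (simp add: mult.assoc inv_simps)
  also have "\<dots> = t * R' * S * R"
    unfolding w by (simp add: mult.assoc inv_simps)
  finally show ?thesis .
qed

end

section \<open>Matrices over a complex algebra\<close>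

interpretation scaleC: vector_space "scaleC :: complex \<Rightarrow> 'a::complex_algebra_1 \<Rightarrow> 'a"
  by unfold_locales (simp_all add: scaleC_add_right scaleC_add_left scaleC_scaleC scaleC_one)

text \<open>
  The class multiplication on vectors is componentwise, so matrices need their own type to become
  an instance of \<open>ring_1\<close> whose product is \<open>**\<close>.
\<close>

datatype ('a, 'n) matrix_ring = Ring_Of (mat_of: "('a, 'n) sqmat")

instantiation matrix_ring :: (ring_1, finite) ring_1
begin

definition "0 = Ring_Of 0"
definition "1 = Ring_Of (mat 1)"
definition "x + y = Ring_Of (mat_of x + mat_of y)"
definition "x - y = Ring_Of (mat_of x - mat_of y)"
definition "- x = Ring_Of (- mat_of x)"
definition "x * y = Ring_Of (mat_of x ** mat_of y)"

instance
proof
  fix x y z :: "('a, 'b) matrix_ring"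
  show "x * y * z = x * (y * z)"
    by (simp add: times_matrix_ring_def matrix_mul_assoc)
  show "(x + y) * z = x * z + y * z" "x * (y + z) = x * y + x * z"
    by (simp_all add: times_matrix_ring_def plus_matrix_ring_def matrix_matrix_mult_def vec_eq_iff
        algebra_simps sum.distrib)
  have "mat 0 \<noteq> (mat 1 :: ('a, 'b) sqmat)"
    by (simp add: mat_def vec_eq_iff)
  then show "(0 :: ('a, 'b) matrix_ring) \<noteq> 1"
    by (simp add: zero_matrix_ring_def one_matrix_ring_def mat_def zero_vec_def vec_eq_iff)
qed (simp_all add: times_matrix_ring_def plus_matrix_ring_def minus_matrix_ring_def
    uminus_matrix_ring_def zero_matrix_ring_def one_matrix_ring_def algebra_simps)

end

lemma Ring_Of_simps [simp]:
  fixes A B :: "('a::ring_1, 'n::finite) sqmat"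
  shows "Ring_Of A + Ring_Of B = Ring_Of (A + B)"
    and "Ring_Of A - Ring_Of B = Ring_Of (A - B)"
    and "- Ring_Of A = Ring_Of (- A)"
    and "Ring_Of A * Ring_Of B = Ring_Of (A ** B)"
    and "1 = Ring_Of A \<longleftrightarrow> mat 1 = A"
    and "Ring_Of A = 1 \<longleftrightarrow> A = mat 1"
  by (auto simp: times_matrix_ring_def plus_matrix_ring_def minus_matrix_ring_def
    uminus_matrix_ring_def one_matrix_ring_def)

lemma Ring_Of_mat_1: "1 = Ring_Of (mat 1)"
  by simp

lemma matrix_distribs:
  fixes A B C :: "('a::ring_1, 'n::finite) sqmat"
  shows "A ** (B + C) = A ** B + A ** C" "(A + B) ** C = A ** C + B ** C"
    "A ** (B - C) = A ** B - A ** C" "(A - B) ** C = A ** C - B ** C"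
    "A ** (- B) = - (A ** B)" "(- A) ** B = - (A ** B)"
  using distrib_left[of "Ring_Of A" "Ring_Of B" "Ring_Of C"]
    distrib_right[of "Ring_Of A" "Ring_Of B" "Ring_Of C"]
    right_diff_distrib[of "Ring_Of A" "Ring_Of B" "Ring_Of C"]
    left_diff_distrib[of "Ring_Of A" "Ring_Of B" "Ring_Of C"]
    mult_minus_right[of "Ring_Of A" "Ring_Of B"] mult_minus_left[of "Ring_Of A" "Ring_Of B"]
  by simp_all

lemma matrix_inv:
  fixes A :: "('a::ring_1, 'n::finite) sqmat"
  assumes "invertible A"
  shows "A ** matrix_inv A = mat 1" "matrix_inv A ** A = mat 1"
  using someI_ex[OF assms[unfolded invertible_def]] by (auto simp: matrix_inv_def)

lemma matrix_inv_unique: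
  fixes A B :: "('a::ring_1, 'n::finite) sqmat"
  assumes "A ** B = mat 1" "B ** A = mat 1"
  shows "matrix_inv A = B"
proof -
  have "invertible A" using assms by (auto simp: invertible_def)
  then show ?thesis
    by (metis assms(2) matrix_inv(1) matrix_mul_assoc matrix_mul_lid matrix_mul_rid)
qed

lemma mscale_mult:
  fixes A B :: "('a::complex_algebra_1, 'n::finite) sqmat"
  shows "mscale c A ** B = mscale c (A ** B)" "A ** mscale c B = mscale c (A ** B)"
  by (simp_all add: mscale_def matrix_matrix_mult_def vec_eq_iff mult_scaleC_left mult_scaleC_right
      scaleC.scale_sum_right)

text \<open>Writes scaling as a matrix product, so that \<lambda> can serve as the central ring
  element \<open>c\<close>.\<close>

lemma mscale_mat_1:
  fixes A :: "('a::complex_algebra_1, 'n::finite) sqmat"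
  shows "mat (c *\<^sub>C 1) ** A = mscale c A" "A ** mat (c *\<^sub>C 1) = mscale c A"
proof -
  have "mat (c *\<^sub>C 1) = mscale c (mat 1 :: ('a, 'n) sqmat)"
    by (simp add: mscale_def mat_def vec_eq_iff)
  then show "mat (c *\<^sub>C 1) ** A = mscale c A" "A ** mat (c *\<^sub>C 1) = mscale c A"
    by (simp_all add: mscale_mult)
qed

lemma num_mat_mult_nth:
  fixes X Y :: "('a::complex_algebra_1, 'n::finite) sqmat"
  shows "(num_mat M ** X) $ i $ j = (\<Sum>k\<in>UNIV. M $ i $ k *\<^sub>C X $ k $ j)"
  "(Y ** num_mat M) $ i $ j = (\<Sum>k\<in>UNIV. M $ k $ j *\<^sub>C Y $ i $ k)"
  by (simp_all add: num_mat_def matrix_matrix_mult_def mult_scaleC_left mult_scaleC_right)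

lemma num_mat_mult:
  fixes A B :: "(complex, 'n::finite) sqmat"
  shows "num_mat (A ** B) = num_mat A ** num_mat B"
  by (simp add: vec_eq_iff num_mat_mult_nth)
    (simp add: num_mat_def matrix_matrix_mult_def scaleC_scaleC scaleC.scale_sum_left
      mult.commute)

lemma sum_UNIV_pair:
  fixes f :: "'a::finite \<times> 'b::finite \<Rightarrow> 'c::comm_monoid_add"
  shows "(\<Sum>x\<in>UNIV. f x) = (\<Sum>a\<in>UNIV. \<Sum>b\<in>UNIV. f (a, b))"
  by (simp add: sum.cartesian_product UNIV_Times_UNIV[symmetric] del: UNIV_Times_UNIV)

lemma sum_if_const: "(\<Sum>x\<in>A. if P then f x else 0) = (if P then sum f A else 0)"
  by simp

lemma mat_mult_nth:
  fixes A :: "('a::ring_1, 'n::finite) sqmat"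
  shows "(mat a ** A) $ i $ j = a * A $ i $ j" "(A ** mat a) $ i $ j = A $ i $ j * a"
  by (simp_all add: matrix_matrix_mult_def mat_def if_distrib[of "\<lambda>x. x * _"]
      if_distrib[of "\<lambda>x. _ * x"] cong: if_cong)

text \<open>The matrix \<open>mat x\<close> is in general not central; with it, entrywise
  (anti)commutators become identities between matrix products.\<close>

lemma comm_eq: "comm x A = mat x ** A - A ** mat x"
  and anticomm_eq: "anticomm x A = mat x ** A + A ** mat x"
  for A :: "('a::ring_1, 'n::finite) sqmat"
  by (simp_all add: comm_def anticomm_def vec_eq_iff mat_mult_nth)

lemma leg2_mult_nth:
  fixes A :: "('a::ring_1, 'n::finite) sqmat"
  shows "(leg2 A ** X) $ (i1, i2) $ j = (\<Sum>k\<in>UNIV. A $ i2 $ k * X $ (i1, k) $ j)"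
    "(X ** leg2 A) $ i $ (j1, j2) = (\<Sum>k\<in>UNIV. X $ i $ (j1, k) * A $ k $ j2)"
  by (simp_all add: matrix_matrix_mult_def leg2_def sum_UNIV_pair if_distrib[of "\<lambda>x. x * _"]
      if_distrib[of "\<lambda>x. _ * x"] sum_if_const cong: if_cong)

lemma leg2_hom:
  fixes A B :: "('a::ring_1, 'n::finite) sqmat"
  shows "leg2 (A ** B) = leg2 A ** leg2 B" "leg2 (A + B) = leg2 A + leg2 B"
    "leg2 (mat 1 :: ('a, 'n) sqmat) = mat 1"
    by (simp_all add: vec_eq_iff leg2_mult_nth)
     (auto simp: matrix_matrix_mult_def leg2_def mat_def)

lemma leg1_mult_nth:
  fixes A :: "('a::ring_1, 'n::finite) sqmat"
  shows "(leg1 A ** X) $ (i1, i2) $ j = (\<Sum>k\<in>UNIV. A $ i1 $ k * X $ (k, i2) $ j)"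
  by (simp_all add: matrix_matrix_mult_def leg1_def sum_UNIV_pair if_distrib[of "\<lambda>x. x * _"]
     cong: if_cong)

lemma leg1_hom:
  fixes A B :: "('a::ring_1, 'n::finite) sqmat"
  shows "leg1 (A ** B) = leg1 A ** leg1 B" "leg1 (A + B) = leg1 A + leg1 B"
    "leg1 (mat 1 :: ('a, 'n) sqmat) = mat 1"
    by (simp_all add: vec_eq_iff leg1_mult_nth)
     (auto simp: matrix_matrix_mult_def leg1_def mat_def)

lemma leg_mscale:
  shows "leg1 (mscale c A) = mscale c (leg1 A)" "leg2 (mscale c A) = mscale c (leg2 A)"
  by (simp_all add: vec_eq_iff leg1_def leg2_def mscale_def)

section \<open>The braid matrix and the partial quantum trace\<close>

definition weight :: "complex \<Rightarrow> 'n::{finite,linorder} \<Rightarrow> complex"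
  where "weight q i = q ^ (2 * (CARD('n) - pos i) + 1)"

text \<open>In row (i, j) of the braid matrix, \<open>swap_coeff\<close> stands in column (j, i) and
  \<open>id_coeff\<close> in column (i, j). The permutation exchanges the row indices, so the
  condition i > j of \<open>Theta\<close> becomes i < j.\<close>

definition swap_coeff :: "complex \<Rightarrow> 'n \<Rightarrow> 'n \<Rightarrow> complex"
  where "swap_coeff q i j = (if i = j then q else 1)"

definition id_coeff :: "complex \<Rightarrow> 'n::linorder \<Rightarrow> 'n \<Rightarrow> complex"
  where "id_coeff q i j = (if i < j then lam q else 0)"

lemma sum_weight_atLeast:
  fixes i :: "'n::{finite,linorder}"
  assumes "q \<noteq> 0"
  shows "lam q * (\<Sum>k\<in>{i..}. weight q k) = q * weight q i - 1"
proof -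
  \<comment> \<open>The weight of \<open>k\<close> is \<open>q ^ (2 * h k + 1)\<close>, and
    \<open>h\<close> maps \<open>{i..}\<close> bijectively onto \<open>{..h i}\<close>: the sum is
    geometric with ratio q^2.\<close>
  define h :: "'n \<Rightarrow> nat" where "h k = card {k<..}" for k
  have pos: "CARD('n) - pos k = h k" for k :: 'n
  proof -
    have "{k<..} = UNIV - {m. m \<le> k}" by auto
    then show ?thesis by (simp add: h_def pos_def card_Diff_subset)
  qed
  have less: "h k' < h k" if "k < k'" for k k'
    unfolding h_def by (rule psubset_card_mono) (use that in auto)
  have inj: "inj_on h {i..}"
    by (rule inj_onI) (metis less less_irrefl linorder_neqE)
  have "h ` {i..} = {..h i}"
  proof (rule card_subset_eq)
    show "h ` {i..} \<subseteq> {..h i}"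
      using less by (auto simp: le_less)
    have "{i..} = insert i {i<..}" by auto
    then have "card {i..} = Suc (h i)" by (simp add: h_def)
    then show "card (h ` {i..}) = card {..h i}"
      by (simp add: card_image inj)
  qed auto
  then have "(\<Sum>k\<in>{i..}. weight q k) = (\<Sum>m\<le>h i. q ^ (2 * m + 1))"
    using sum.reindex[OF inj, of "\<lambda>m. q ^ (2 * m + 1)"] by (simp add: weight_def pos)
  \<comment> \<open>The sum telescopes, since \<lambda> q^(2m+1) = q^(2m+2) - q^(2m).\<close>
  moreover have "lam q * (\<Sum>m\<le>n. q ^ (2 * m + 1)) = q ^ (2 * n + 2) - 1" for n
    using assms by (induction n) (simp_all add: lam_def field_simps power2_eq_square)
  ultimately show ?thesis
    by (simp add: weight_def pos)
qed

text \<open>The first term supplies the weights from \<open>i\<close> on, the second those below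
  \<open>i\<close>. Independence of \<open>i\<close> is what makes the partial quantum trace of the
  braid matrix scalar.\<close>

lemma sum_weight_id_coeff:
  fixes i :: "'n::{finite,linorder}"
  assumes "q \<noteq> 0"
  shows "q * weight q i + (\<Sum>k\<in>UNIV. weight q k * id_coeff q k i) =
    1 + lam q * (\<Sum>k\<in>(UNIV :: 'n set). weight q k)"
proof -
  have "(\<Sum>k\<in>UNIV. weight q k * id_coeff q k i) = lam q * (\<Sum>k\<in>{..<i}. weight q k)"
    by (simp add: id_coeff_def if_distrib[of "\<lambda>x. _ * x"] sum.If_cases sum_distrib_left mult.commute
        lessThan_def cong: if_cong)
  moreover have
    "(\<Sum>k\<in>(UNIV :: 'n set). weight q k) = (\<Sum>k\<in>{..<i}. weight q k) + (\<Sum>k\<in>{i..}. weight q k)"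
  proof -
    have "sum (weight q) ({..<i} \<union> {i..}) = sum (weight q) {..<i} + sum (weight q) {i..}"
      by (rule sum.union_disjoint) auto
    moreover have "{..<i} \<union> {i..} = (UNIV :: 'n set)" by auto
    ultimately show ?thesis by simp
  qed
  ultimately show ?thesis
    using sum_weight_atLeast[OF assms, of i] by (simp add: algebra_simps)
qed

lemma swap_coeff_commute: "swap_coeff q i j = swap_coeff q j i"
  by (auto simp: swap_coeff_def)

lemma Rhat_mat_nth:
  fixes i1 i2 j1 j2 :: "'n::{finite,linorder}"
  shows "Rhat_mat q $ (i1, i2) $ k = (if k = (i2, i1) then swap_coeff q i1 i2 else 0) +
      (if k = (i1, i2) then id_coeff q i1 i2 else 0)"
  "Rhat_mat q $ k $ (j1, j2) = (if k = (j2, j1) then swap_coeff q j1 j2 else 0) +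
      (if k = (j1, j2) then id_coeff q j1 j2 else 0)"
proof -
  have *: "(P_mat ** X) $ (i1, i2) $ j = X $ (i2, i1) $ j"
    for X :: "(complex, 'n \<times> 'n) sqmat" and i1 i2 :: 'n and j
  proof -
    have "P_mat $ (i1, i2) $ k = (if k = (i2, i1) then 1 else 0)" for k
      by (cases k) (auto simp add: P_mat_def delta_def)
    then show ?thesis
      by (simp add: matrix_matrix_mult_def if_distrib[of "\<lambda>x. x * _"] cong: if_cong)
  qed
  have R: "Rhat_mat q $ (i1, i2) $ (j1, j2) =
      (if i1 = j2 \<and> i2 = j1 then swap_coeff q i1 i2 else 0) +
      (if i1 = j1 \<and> i2 = j2 then id_coeff q i1 i2 else 0)" for i1 i2 j1 j2 :: 'n
    unfolding Rhat_mat_def * R_mat_def vec_lambda_beta prod.case swap_coeff_def id_coeff_def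
      delta_def Theta_def lam_def
    by (cases "i1 = i2"; cases "i1 = j1"; cases "i1 = j2"; cases "i2 = j1"; cases "i2 = j2"; simp)
  show "Rhat_mat q $ (i1, i2) $ k = (if k = (i2, i1) then swap_coeff q i1 i2 else 0) +
      (if k = (i1, i2) then id_coeff q i1 i2 else 0)"
    by (cases k) (simp add: R)
  show "Rhat_mat q $ k $ (j1, j2) = (if k = (j2, j1) then swap_coeff q j1 j2 else 0) +
      (if k = (j1, j2) then id_coeff q j1 j2 else 0)"
  proof (cases k)
    case (Pair a b)
    show ?thesis
      unfolding Pair R by (rule arg_cong2[of _ _ _ _ plus]) (simp_all add: swap_coeff_def)
  qed
qed

lemma Rhat_mat_mult_nth:
  fixes X :: "(complex, 'n::{finite,linorder} \<times> 'n) sqmat"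
  shows "(Rhat_mat q ** X) $ (i1, i2) $ j = swap_coeff q i1 i2 * X $ (i2, i1) $ j +
    id_coeff q i1 i2 * X $ (i1, i2) $ j"
  by (simp add: matrix_matrix_mult_def Rhat_mat_nth(1) distrib_right sum.distrib
      if_distrib[of "\<lambda>x. x * _"] cong: if_cong)

lemma Rhat_mult_nth:
  fixes X :: "('a::complex_algebra_1, 'n::{finite,linorder} \<times> 'n) sqmat"
  shows "(Rhat q ** X) $ (i1, i2) $ j = swap_coeff q i1 i2 *\<^sub>C X $ (i2, i1) $ j +
    id_coeff q i1 i2 *\<^sub>C X $ (i1, i2) $ j"
  "(X ** Rhat q) $ i $ (j1, j2) = swap_coeff q j1 j2 *\<^sub>C X $ i $ (j2, j1) +
    id_coeff q j1 j2 *\<^sub>C X $ i $ (j1, j2)"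
  by (simp_all add: Rhat_def num_mat_mult_nth Rhat_mat_nth
     scaleC.scale_left_distrib sum.distrib
      if_distrib[of "\<lambda>x. x *\<^sub>C _"] cong: if_cong)

lemma matrix_inv_Rhat_mat:
  fixes q :: complex
  assumes "q \<noteq> 0"
  defines "R \<equiv> Rhat_mat q :: (complex, 'n::{finite,linorder} \<times> 'n) sqmat"
  shows "R ** (R - mat (lam q)) = mat 1" "(R - mat (lam q)) ** R = mat 1"
    "matrix_inv R = R - mat (lam q)"
proof -
  have lam: "q * q = 1 + lam q * q"
    using assms by (simp add: lam_def algebra_simps)
  have "(R ** R) $ (i1, i2) $ j = (mat 1 + mat (lam q) ** R) $ (i1, i2) $ j" for i1 i2 j
  proof -
    \<comment> \<open>Both indicators coincide when \<open>i1 = i2\<close>, the case that rests on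
      q^2 = 1 + \<lambda> q.\<close>
    define a b :: complex where "a = (if j = (i1, i2) then 1 else 0)" and
      "b = (if j = (i2, i1) then 1 else 0)"
    have R: "R $ (i1, i2) $ j = swap_coeff q i1 i2 * b + id_coeff q i1 i2 * a"
      "R $ (i2, i1) $ j = swap_coeff q i2 i1 * a + id_coeff q i2 i1 * b"
      by (cases "i1 = i2"; simp add: R_def Rhat_mat_nth(1) a_def b_def)+
    have "mat 1 $ (i1, i2) $ j = a"
      by (auto simp: mat_def a_def)
    moreover have "i1 = i2 \<Longrightarrow> a = b"
      by (simp add: a_def b_def)
    moreover have "q * (q * a) = a + lam q * (q * a)"
      using arg_cong[OF lam, of "\<lambda>x. x * a"] by (simp add: algebra_simps)
    ultimately show ?thesis
      unfolding vector_add_component mat_mult_nth Rhat_mat_mult_nth[of q R, folded R_def] R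
      by (cases i1 i2 rule: linorder_cases) (auto simp: swap_coeff_def id_coeff_def algebra_simps)
  qed
  then have R: "R ** R = mat 1 + mat (lam q) ** R" by (auto simp: vec_eq_iff)
  moreover have "R ** mat (lam q) = mat (lam q) ** R"
    by (simp add: vec_eq_iff mat_mult_nth mult.commute)
  ultimately show 1: "R ** (R - mat (lam q)) = mat 1" "(R - mat (lam q)) ** R = mat 1"
    by (simp_all add: matrix_distribs)
  show "matrix_inv R = R - mat (lam q)" by (rule matrix_inv_unique[OF 1])
qed

lemma Rhat_inverse:
  fixes q :: complex
  assumes "q \<noteq> 0"
  defines "R \<equiv> Rhat q :: ('a::complex_algebra_1, 'n::{finite,linorder} \<times> 'n) sqmat"
  shows "R ** Rhat_inv q = mat 1" "Rhat_inv q ** R = mat 1" "Rhat_inv q = R - mat (lam q *\<^sub>C 1)"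
proof -
  have m: "num_mat (mat c) = mat (c *\<^sub>C 1)" for c
    by (simp add: num_mat_def mat_def vec_eq_iff)
  show "R ** Rhat_inv q = mat 1" "Rhat_inv q ** R = mat 1"
    by (simp_all add: R_def Rhat_def Rhat_inv_def num_mat_mult[symmetric] matrix_inv_Rhat_mat
      assms m
      scaleC_one)
  have d: "num_mat (A - B) = num_mat A - num_mat B" for A B
    by (simp add: num_mat_def vec_eq_iff scaleC.scale_left_diff_distrib)
  show "Rhat_inv q = R - mat (lam q *\<^sub>C 1)"
    by (simp add: R_def Rhat_def Rhat_inv_def matrix_inv_Rhat_mat assms d m)
qed

section \<open>Partial quantum trace over the first factor\<close>

lemma Tr_q_eq: "Tr_q q A = (\<Sum>k\<in>UNIV. weight q k *\<^sub>C A $ k $ k)"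
  by (simp add: Tr_q_def trace_def num_mat_mult_nth D_inv_def delta_def weight_def
     if_distrib[of "\<lambda>x. _ * x"] if_distrib[of "\<lambda>x. x *\<^sub>C _"] cong: if_cong)

definition Tr_q1 ::
  "complex \<Rightarrow> ('a::complex_algebra_1, 'n::{finite,linorder} \<times> 'n) sqmat \<Rightarrow> ('a, 'n) sqmat"
  where "Tr_q1 q X = (\<chi> i j. \<Sum>k\<in>UNIV. weight q k *\<^sub>C X $ (k, i) $ (k, j))"

lemma Tr_q1_linear:
  "Tr_q1 q (X + Y) = Tr_q1 q X + Tr_q1 q Y" "Tr_q1 q (X - Y) = Tr_q1 q X - Tr_q1 q Y"
  "Tr_q1 q (- X) = - Tr_q1 q X"
  "Tr_q1 q (mscale c X) = mscale c (Tr_q1 q X)"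
  by (simp_all add: Tr_q1_def mscale_def vec_eq_iff sum.distrib sum_subtractf sum_negf
    scaleC_add_right
      scaleC.scale_right_diff_distrib scaleC.scale_sum_right scaleC_scaleC mult.commute)

lemma Tr_q_linear:
  "Tr_q q (A + B) = Tr_q q A + Tr_q q B" "Tr_q q (A - B) = Tr_q q A - Tr_q q B"
  "Tr_q q (- A) = - Tr_q q A"
  "Tr_q q (mscale c A) = c *\<^sub>C Tr_q q A"
  "Tr_q q (mat a ** A) = a * Tr_q q A" "Tr_q q (A ** mat a) = Tr_q q A * a"
  by (simp_all add: Tr_q_eq mscale_def mat_mult_nth sum.distrib sum_subtractf sum_negf
    scaleC_add_right
      scaleC.scale_right_diff_distrib scaleC.scale_sum_right scaleC_scaleC mult.commute
      sum_distrib_left sum_distrib_right mult_scaleC_left mult_scaleC_right)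

text \<open>\<open>leg2 A\<close> acts on the untraced factor and the weights are scalars, so
  \<open>A\<close> comes out on its own side and no noncommuting entries are reordered.\<close>

lemma Tr_q1_leg2_mult: "Tr_q1 q (leg2 A ** X) = A ** Tr_q1 q X"
  "Tr_q1 q (X ** leg2 A) = Tr_q1 q X ** A"
proof -
  show "Tr_q1 q (leg2 A ** X) = A ** Tr_q1 q X"
    by (simp add: vec_eq_iff Tr_q1_def leg2_mult_nth scaleC.scale_sum_right, subst sum.swap)
      (simp add: matrix_matrix_mult_def sum_distrib_left mult_scaleC_right)
  show "Tr_q1 q (X ** leg2 A) = Tr_q1 q X ** A"
    by (simp add: vec_eq_iff Tr_q1_def leg2_mult_nth scaleC.scale_sum_right, subst sum.swap)
      (simp add: matrix_matrix_mult_def sum_distrib_right mult_scaleC_left)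
qed

lemma Tr_q1_leg1: "Tr_q1 q (leg1 A) = mat (Tr_q q A)"
  by (simp add: vec_eq_iff Tr_q1_def leg1_def Tr_q_eq mat_def)

lemma Tr_q1_Rhat_inv:
  fixes q :: complex
  assumes "q \<noteq> 0"
  shows "Tr_q1 q (Rhat_inv q :: ('a::complex_algebra_1, 'n::{finite,linorder} \<times> 'n) sqmat) = mat 1"
proof -
  have "(\<Sum>k\<in>UNIV. weight q k *\<^sub>C (Rhat_inv q :: ('a, 'n \<times> 'n) sqmat) $ (k, i) $ (k, j)) =
      (if i = j then 1 else 0)" for i j
  proof -
    have "weight q k *\<^sub>C (Rhat_inv q :: ('a, 'n \<times> 'n) sqmat) $ (k, i) $ (k, j) =
      (if i = j then (if k = i then q * weight q k else 0) +
        weight q k * id_coeff q k i - lam q * weight q k else 0) *\<^sub>C 1" for k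
      by (auto simp: Rhat_inverse[OF assms] Rhat_def num_mat_def Rhat_mat_nth(1) mat_def
        swap_coeff_def
         scaleC_scaleC algebra_simps scaleC.scale_right_diff_distrib scaleC.scale_left_diff_distrib)
    then have "(\<Sum>k\<in>UNIV. weight q k *\<^sub>C (Rhat_inv q :: ('a, 'n \<times> 'n) sqmat) $ (k, i) $ (k, j)) =
      (\<Sum>k\<in>UNIV. if i = j then (if k = i then q * weight q k else 0) +
        weight q k * id_coeff q k i - lam q * weight q k else 0) *\<^sub>C 1"
      by (simp add: scaleC.scale_sum_left)
    also have "\<dots> = (if i = j then 1 else 0)"
      using sum_weight_id_coeff[OF assms, of i]
      by (auto simp: sum.distrib sum_subtractf sum_distrib_left scaleC_one)
    finally show ?thesis .
  qed
  then show ?thesis by (simp add: Tr_q1_def mat_def vec_eq_iff)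
qed

text \<open>Computed entrywise from R' = R - \<lambda>: terms with two swaps give the trace of
  \<open>A\<close>, and the rest cancels by \<open>sum_weight_id_coeff\<close>.\<close>

lemma Tr_q1_Rhat_conj:
  fixes A :: "('a::complex_algebra_1, 'n::{finite,linorder}) sqmat"
  assumes "q \<noteq> 0"
  shows "Tr_q1 q (Rhat q ** leg2 A ** Rhat_inv q) = mat (Tr_q q A)"
proof -
  have id_coeff_self: "id_coeff q k k = 0" for k :: 'n
    by (simp add: id_coeff_def)
  have leg2: "leg2 A $ (a, b) $ (c, d) = (if a = c then A $ b $ d else 0)" for a b c d
    by (simp add: leg2_def)
  have lam: "q * (q * x) = x + lam q * (q * x)" for x
    using assms by (simp add: lam_def algebra_simps)
  have "(\<Sum>k\<in>UNIV. weight q k *\<^sub>C (Rhat q ** leg2 A ** Rhat_inv q) $ (k, i) $ (k, j)) =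
    (if i = j then Tr_q q A else 0)" for i j
  proof -
    \<comment> \<open>\<open>c k\<close> is the coefficient of \<open>A $ i $ j\<close> in the
      summand for \<open>k\<close>, apart from the double swap, which contributes
      \<open>A $ k $ k\<close>.\<close>
    define c where "c k = (if k = i then weight q i * q * id_coeff q i j else 0)
      + (if k = j then weight q j * q * id_coeff q j i else 0) +
        weight q k * id_coeff q k i * id_coeff q k j
      - lam q * ((if k = i then q * weight q i else 0) + weight q k * id_coeff q k i)" for k
    have RAR: "Rhat q ** leg2 A ** Rhat_inv q =
      Rhat q ** (leg2 A ** Rhat q) - mscale (lam q) (Rhat q ** leg2 A)"
      by (simp add: Rhat_inverse(3)[OF assms] matrix_distribs mscale_mat_1 matrix_mul_assoc)
    have "weight q k *\<^sub>C (Rhat q ** leg2 A ** Rhat_inv q) $ (k, i) $ (k, j) =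
        (if i = j then (weight q k * swap_coeff q k i * swap_coeff q k j) *\<^sub>C A $ k $ k else 0) +
          c k *\<^sub>C A $ i $ j" for k
      unfolding RAR by (cases "i = j"; cases "k = i"; cases "k = j")
        (simp_all add: Rhat_mult_nth mscale_def leg2 c_def id_coeff_self swap_coeff_def
          scaleC_scaleC
          scaleC.scale_left_distrib scaleC.scale_right_distrib scaleC.scale_left_diff_distrib
          scaleC.scale_right_diff_distrib algebra_simps)
    then have "(\<Sum>k\<in>UNIV. weight q k *\<^sub>C (Rhat q ** leg2 A ** Rhat_inv q) $ (k, i) $ (k, j)) =
        (if i = j then \<Sum>k\<in>UNIV. (weight q k * swap_coeff q k i * swap_coeff q k j) *\<^sub>C A $ k $ k
          else 0) + sum c UNIV *\<^sub>C A $ i $ j"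
      by (simp add: sum.distrib scaleC.scale_sum_left)
    moreover have "sum c UNIV = weight q i * q * id_coeff q i j + weight q j * q * id_coeff q j i
        + (\<Sum>k\<in>UNIV. weight q k * id_coeff q k i * id_coeff q k j)
        - lam q * (q * weight q i + (\<Sum>k\<in>UNIV. weight q k * id_coeff q k i))"
      by (simp add: c_def sum.distrib sum_subtractf flip: sum_distrib_left)
    \<comment> \<open>A summand vanishes unless \<open>k\<close> lies below both \<open>i\<close>
      and \<open>j\<close>.\<close>
    moreover have "(\<Sum>k\<in>UNIV. weight q k * id_coeff q k i * id_coeff q k j) =
        lam q * (\<Sum>k\<in>UNIV. weight q k * id_coeff q k (min i j))"
      unfolding sum_distrib_left by (rule sum.cong) (auto simp: id_coeff_def)
    ultimately have sum:
      "(\<Sum>k\<in>UNIV. weight q k *\<^sub>C (Rhat q ** leg2 A ** Rhat_inv q) $ (k, i) $ (k, j)) =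
        (if i = j then \<Sum>k\<in>UNIV. (weight q k * swap_coeff q k i * swap_coeff q k j) *\<^sub>C A $ k $ k
          else 0)
        + (weight q i * q * id_coeff q i j + weight q j * q * id_coeff q j i
          + lam q * (\<Sum>k\<in>UNIV. weight q k * id_coeff q k (min i j))
          - lam q * (q * weight q i + (\<Sum>k\<in>UNIV. weight q k * id_coeff q k i))) *\<^sub>C A $ i $ j"
      by simp
    show ?thesis
    proof (cases "i = j")
      case True
      \<comment> \<open>The surplus at \<open>k = j\<close>, from q^2 = 1 + \<lambda> q, cancels
        what is left of \<open>sum c UNIV\<close>.\<close>
      have "(weight q k * swap_coeff q k j * swap_coeff q k j) *\<^sub>C A $ k $ k =
        weight q k *\<^sub>C A $ k $ k +
          (if k = j then (lam q * (q * weight q j)) *\<^sub>C A $ j $ j else 0)" for k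
        by (cases "k = j") (simp_all add: swap_coeff_def lam mult.commute flip:
          scaleC.scale_left_distrib)
      then show ?thesis
        using True unfolding sum by (simp add: sum.distrib id_coeff_self Tr_q_eq algebra_simps)
    next
      case False
      define C where "C = 1 + lam q * (\<Sum>k\<in>(UNIV :: 'n set). weight q k)"
      have U: "(\<Sum>k\<in>UNIV. weight q k * id_coeff q k m) = C - q * weight q m" for m :: 'n
        using sum_weight_id_coeff[OF assms, of m] by (simp add: C_def algebra_simps)
      have "weight q i * q * id_coeff q i j + weight q j * q * id_coeff q j i
          + lam q * (\<Sum>k\<in>UNIV. weight q k * id_coeff q k (min i j)) =
        lam q * (q * weight q i + (\<Sum>k\<in>UNIV. weight q k * id_coeff q k i))"
        unfolding U using False
        by (cases i j rule: linorder_cases) (auto simp: id_coeff_def algebra_simps)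
      then show ?thesis
        using False unfolding sum by simp
    qed
  qed
  then show ?thesis by (simp add: vec_eq_iff Tr_q1_def mat_def)
qed

text \<open>The two conjugations differ by \<lambda> (R' A - A R'), whose partial trace is \<lambda>
  (A - A) = 0.\<close>

lemma Tr_q1_Rhat_conj':
  fixes A :: "('a::complex_algebra_1, 'n::{finite,linorder}) sqmat"
  assumes "q \<noteq> 0"
  shows "Tr_q1 q (Rhat_inv q ** leg2 A ** Rhat q) = mat (Tr_q q A)"
proof -
  let ?R = "Rhat q :: ('a, 'n \<times> 'n) sqmat" and ?R' = "Rhat_inv q :: ('a, 'n \<times> 'n) sqmat"
  let ?l = "mat (lam q *\<^sub>C 1) :: ('a, 'n \<times> 'n) sqmat"
  have R: "?R = ?R' + ?l" by (simp add: Rhat_inverse(3)[OF assms])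
  have "?R' ** leg2 A ** ?R = ?R' ** leg2 A ** ?R' + ?R' ** leg2 A ** ?l"
    unfolding R by (simp add: matrix_distribs)
  also have "\<dots> = ?R ** leg2 A ** ?R' - mscale (lam q) (leg2 A ** ?R') +
    mscale (lam q) (?R' ** leg2 A)"
    unfolding R by (simp add: matrix_distribs mscale_mat_1 mscale_mult)
  finally show ?thesis
    by (simp add: Tr_q1_linear Tr_q1_leg2_mult Tr_q1_Rhat_inv Tr_q1_Rhat_conj assms)
qed

text \<open>Cyclicity of the trace over both factors holds for the braid matrix because its entries
  are scalars and the product of the two weights is symmetric.\<close>

lemma Tr_q_Tr_q1_commute: "Tr_q q (Tr_q1 q (Rhat q ** X)) = Tr_q q (Tr_q1 q (X ** Rhat q))"
proof -
  have "(\<Sum>i\<in>UNIV. \<Sum>k\<in>UNIV. (weight q i * (weight q k * swap_coeff q k i)) *\<^sub>C X $ (i, k) $ (k, i)) =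
    (\<Sum>i\<in>UNIV. \<Sum>k\<in>UNIV. (weight q i * (weight q k * swap_coeff q k i)) *\<^sub>C X $ (k, i) $ (i, k))"
    by (subst sum.swap) (simp add: swap_coeff_commute mult_ac)
  then show ?thesis
    by (simp add: Tr_q_eq Tr_q1_def Rhat_mult_nth scaleC_add_right scaleC_scaleC
      scaleC.scale_sum_right sum.distrib)
qed

text \<open>The correction \<open>- mscale (lam q) A\<close> is the source of T \<omega> in [Q, T]
  and of \<omega>^2 in the anticommutator with \<omega>.\<close>

lemma Tr_q1_Rhat_inv_conj:
  fixes A :: "('a::complex_algebra_1, 'n::{finite,linorder}) sqmat"
  assumes "q \<noteq> 0"
  shows "Tr_q1 q (Rhat_inv q ** leg2 A ** Rhat_inv q) = mat (Tr_q q A) - mscale (lam q) A"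
proof -
  have "Rhat_inv q ** leg2 A ** Rhat_inv q =
      Rhat q ** leg2 A ** Rhat_inv q - mscale (lam q) (leg2 A ** Rhat_inv q)"
    by (subst (1) Rhat_inverse(3)[OF assms]) (simp add: matrix_distribs mscale_mat_1 mscale_mult)
  then show ?thesis
    by (simp add: Tr_q1_linear Tr_q1_leg2_mult Tr_q1_Rhat_inv Tr_q1_Rhat_conj assms)
qed

lemma Tr_q1_leg2_conj:
  fixes A B :: "('a::complex_algebra_1, 'n::{finite,linorder}) sqmat"
  assumes "q \<noteq> 0"
  shows "Tr_q1 q (leg2 A ** Rhat q ** leg2 B ** Rhat_inv q) = A ** mat (Tr_q q B)"
    "Tr_q1 q (leg2 A ** Rhat_inv q ** leg2 B ** Rhat q) = A ** mat (Tr_q q B)"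
    "Tr_q1 q (leg2 A ** Rhat_inv q ** leg2 B ** Rhat_inv q) =
      A ** (mat (Tr_q q B) - mscale (lam q) B)"
    "Tr_q1 q (leg2 A ** Rhat_inv q ** leg2 B) = A ** B"
  using Tr_q1_leg2_mult(1)[of q A "Rhat q ** leg2 B ** Rhat_inv q"]
    Tr_q1_leg2_mult(1)[of q A "Rhat_inv q ** leg2 B ** Rhat q"]
    Tr_q1_leg2_mult(1)[of q A "Rhat_inv q ** leg2 B ** Rhat_inv q"]
  by (simp_all add: Tr_q1_leg2_mult Tr_q1_Rhat_inv Tr_q1_Rhat_conj Tr_q1_Rhat_conj'
    Tr_q1_Rhat_inv_conj assms
      matrix_mul_assoc)

lemma Tr_q_anticommute:
  fixes X :: "('a::complex_algebra_1, 'n::{finite,linorder}) sqmat"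
  assumes q: "q \<noteq> 0"
    and X: "leg2 X ** Rhat_inv q ** leg2 X =
      - (Rhat q ** leg2 X ** Rhat_inv q ** leg2 X ** Rhat q)"
  shows "mat (Tr_q q X) ** X + X ** mat (Tr_q q X) = mscale (lam q) (X ** X)"
proof -
  have "leg2 X ** Rhat_inv q ** leg2 X ** Rhat_inv q =
      - (Rhat q ** leg2 X ** Rhat_inv q ** leg2 X ** (Rhat q ** Rhat_inv q))"
    by (simp add: X matrix_distribs matrix_mul_assoc)
  then have "leg2 X ** Rhat_inv q ** leg2 X ** Rhat_inv q =
      - (Rhat q ** leg2 X ** Rhat_inv q ** leg2 X)"
    by (simp add: Rhat_inverse(1) q)
  then have "X ** (mat (Tr_q q X) - mscale (lam q) X) = - (mat (Tr_q q X) ** X)"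
    by (metis Tr_q1_leg2_conj(3) Tr_q1_linear(3) Tr_q1_leg2_mult(2) Tr_q1_Rhat_conj q)
  then show ?thesis
    by (simp add: matrix_distribs mscale_mult algebra_simps)
qed

lemma Tr_q_square_eq_0:
  fixes X :: "('a::complex_algebra_1, 'n::{finite,linorder}) sqmat"
  assumes q: "q \<noteq> 0" "q\<^sup>2 \<noteq> - 1"
    and X: "leg2 X ** Rhat_inv q ** leg2 X =
      - (Rhat q ** leg2 X ** Rhat_inv q ** leg2 X ** Rhat q)"
  shows "Tr_q q X * Tr_q q X = 0"
proof -
  let ?x = "Tr_q q X" and ?t = "Tr_q q (X ** X)"
  have x: "?x * ?x + ?x * ?x = lam q *\<^sub>C ?t"
    using arg_cong[OF Tr_q_anticommute[OF q(1) X], of "Tr_q q"] by (simp add: Tr_q_linear)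
  have "?t = - Tr_q q (Tr_q1 q (Rhat q ** leg2 X ** Rhat_inv q ** leg2 X ** Rhat q))"
    using arg_cong[OF X, of "\<lambda>Y. Tr_q q (Tr_q1 q Y)"]
    by (simp add: Tr_q1_leg2_conj q Tr_q1_linear Tr_q_linear)
  also have "\<dots> = - Tr_q q (Tr_q1 q (Rhat q ** (Rhat q ** leg2 X ** Rhat_inv q ** leg2 X)))"
    by (simp add: Tr_q_Tr_q1_commute)
  \<comment> \<open>With R = R' + \<lambda> for the outer factor, R' cancels the inner R and
    \<lambda> leaves a term whose trace is known.\<close>
  also have "Rhat q ** (Rhat q ** leg2 X ** Rhat_inv q ** leg2 X) =
      (Rhat_inv q + mat (lam q *\<^sub>C 1)) ** (Rhat q ** leg2 X ** Rhat_inv q ** leg2 X)"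
    by (subst (1) Rhat_inverse(3)[OF q(1)]) simp
  also have "\<dots> = leg2 X ** Rhat_inv q ** leg2 X +
      mscale (lam q) (Rhat q ** leg2 X ** Rhat_inv q ** leg2 X)"
    by (simp add: matrix_distribs mscale_mat_1 mscale_mult matrix_mul_assoc Rhat_inverse(2) q)
  finally have t: "?t = - (?t + lam q *\<^sub>C (?x * ?x))"
    by (simp add: Tr_q1_linear Tr_q_linear Tr_q1_leg2_conj Tr_q1_leg2_mult Tr_q1_Rhat_conj
      Tr_q1_Rhat_inv q)
  have two: "2 *\<^sub>C y = y + y" for y :: 'a
    using scaleC_add_left[of 1 1 y] by (simp add: scaleC_one)
  \<comment> \<open>Eliminates \<open>?t\<close> between the equations \<open>x\<close> and
    \<open>t\<close>.\<close>
  have "(4 + lam q * lam q) *\<^sub>C (?x * ?x) =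
      2 *\<^sub>C (?x * ?x + ?x * ?x) + lam q *\<^sub>C (lam q *\<^sub>C (?x * ?x))"
    by (simp add: scaleC.scale_right_distrib scaleC_scaleC flip: scaleC.scale_left_distrib)
  also have "\<dots> = lam q *\<^sub>C (?t + ?t + lam q *\<^sub>C (?x * ?x))"
    unfolding x two by (simp add: scaleC_add_right)
  also have "?t + ?t + lam q *\<^sub>C (?x * ?x) = 0"
    using t unfolding eq_neg_iff_add_eq_0 by (simp only: add.assoc)
  finally have "(4 + lam q * lam q) *\<^sub>C (?x * ?x) = 0" by simp
  \<comment> \<open>This number is (q + 1/q)^2.\<close>
  moreover have "4 + lam q * lam q \<noteq> 0"
  proof
    assume "4 + lam q * lam q = 0"
    moreover have "(4 + lam q * lam q) * q\<^sup>2 = (q\<^sup>2 + 1)\<^sup>2"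
      using q(1) by (simp add: lam_def field_simps power2_eq_square)
    ultimately have "q\<^sup>2 + 1 = 0" by simp
    then show False using q(2) by (simp add: eq_neg_iff_add_eq_0)
  qed
  ultimately show ?thesis
    by simp
qed

section \<open>The BRST operator\<close>

context glq_differential_algebra
begin

abbreviation "K \<equiv> K_mat q \<omega> J"
abbreviation "S \<equiv> \<omega> ** L ** matrix_inv K"

lemma leg2_K: "leg2 K = mat 1 + mat (lam q *\<^sub>C 1) ** (leg2 \<omega> ** leg2 J)"
  and leg1_K: "leg1 K = mat 1 + mat (lam q *\<^sub>C 1) ** (leg1 \<omega> ** leg1 J)"
  by (simp_all add: K_mat_def leg1_hom leg2_hom leg_mscale mscale_mat_1)

lemma leg_K_inverse:
  "leg2 K ** leg2 (matrix_inv K) = mat 1" "leg2 (matrix_inv K) ** leg2 K = mat 1"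
  "leg1 (matrix_inv K) ** leg1 K = mat 1"
  by (simp_all add: matrix_inv K_invertible leg1_hom leg2_hom flip: leg1_hom(1) leg2_hom(1))

text \<open>Transports all exchange relations of the abstract ring to matrices on the tensor
  square.\<close>

lemma hecke:
  "hecke_reflection (Ring_Of (Rhat q)) (Ring_Of (Rhat_inv q)) (Ring_Of (mat (lam q *\<^sub>C 1)))
    (Ring_Of (leg2 \<omega>)) (Ring_Of (leg2 L)) (Ring_Of (leg2 J))
    (Ring_Of (leg2 K)) (Ring_Of (leg2 (matrix_inv K)))"
proof
  show "x * Ring_Of (mat (lam q *\<^sub>C 1)) = Ring_Of (mat (lam q *\<^sub>C 1)) * x"
    for x :: "('a, 'n \<times> 'n) matrix_ring"
    by (cases x) (simp add: mscale_mat_1)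
  show "Ring_Of (Rhat q) = Ring_Of (Rhat_inv q) +
    Ring_Of (mat (lam q *\<^sub>C 1) :: ('a, 'n \<times> 'n) sqmat)"
    by (simp add: Rhat_inverse(3) q_nonzero)
  show "Ring_Of (leg2 K) = 1 + Ring_Of (mat (lam q *\<^sub>C 1)) * (Ring_Of (leg2 \<omega>) * Ring_Of (leg2 J))"
    by (simp add: leg2_K Ring_Of_mat_1 del: Ring_Of_simps(5,6))
qed (simp_all add: Rhat_inverse(1,2) q_nonzero leg_K_inverse omega_omega omega_L omega_J L_L J_L
  J_J)

interpretation hecke: hecke_reflection
  "Ring_Of (Rhat q)" "Ring_Of (Rhat_inv q)" "Ring_Of (mat (lam q *\<^sub>C 1))"
  "Ring_Of (leg2 \<omega>)" "Ring_Of (leg2 L)" "Ring_Of (leg2 J)"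
  "Ring_Of (leg2 K)" "Ring_Of (leg2 (matrix_inv K))"
  by (rule hecke)

lemma leg2_S: "leg2 S = leg2 \<omega> ** leg2 L ** leg2 (matrix_inv K)"
  by (simp add: leg2_hom)

section \<open>Commutators and anticommutators with the traces of \<omega> and
  \<open>S\<close>\<close>

lemma Tr_omega_L: "mat (Tr_q q \<omega>) ** L = L ** mat (Tr_q q \<omega>)"
proof -
  have "Rhat_inv q ** leg2 \<omega> ** Rhat q ** leg2 L = leg2 L ** Rhat q ** leg2 \<omega> ** Rhat_inv q"
    using hecke.w_L_conj by simp
  then show ?thesis
    by (metis Tr_q1_leg2_mult(2) Tr_q1_Rhat_conj' Tr_q1_leg2_conj(1) q_nonzero)
qed

lemma Tr_S_L: "mat (Tr_q q S) ** L = L ** mat (Tr_q q S)"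
proof -
  have "Rhat_inv q ** leg2 S ** Rhat q ** leg2 L = leg2 L ** Rhat q ** leg2 S ** Rhat_inv q"
    using hecke.S_L_conj by (simp add: leg2_S)
  then show ?thesis
    by (metis Tr_q1_leg2_mult(2) Tr_q1_Rhat_conj' Tr_q1_leg2_conj(1) q_nonzero)
qed

lemma Tr_omega_J: "mat (Tr_q q \<omega>) ** J + J ** mat (Tr_q q \<omega>) = - mat 1"
proof -
  have "Rhat_inv q ** leg2 \<omega> ** Rhat q ** leg2 J + leg2 J ** Rhat q ** leg2 \<omega> ** Rhat_inv q =
      - Rhat_inv q"
    using hecke.w_J_conj by simp
  from arg_cong[OF this, of "Tr_q1 q"] show ?thesis
    by (simp add: Tr_q1_linear Tr_q1_leg2_conj Tr_q1_leg2_mult(2) Tr_q1_Rhat_conj' Tr_q1_Rhat_inv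
      q_nonzero)
qed

lemma Tr_S_J: "mat (Tr_q q S) ** J + J ** mat (Tr_q q S) = - L"
proof -
  have "Rhat_inv q ** leg2 S ** Rhat q ** leg2 J + leg2 J ** Rhat q ** leg2 S ** Rhat_inv q =
      - (leg2 (L ** matrix_inv K) ** Rhat_inv q ** leg2 K)"
    using hecke.S_J_conj by (simp add: leg2_S leg2_hom)
  from arg_cong[OF this, of "Tr_q1 q"] show ?thesis
    by (simp add: Tr_q1_linear Tr_q1_leg2_conj Tr_q1_leg2_mult(2) Tr_q1_Rhat_conj' q_nonzero)
      (simp add: Tr_q1_leg2_mult Tr_q1_Rhat_inv q_nonzero matrix_inv K_invertible flip:
        matrix_mul_assoc)
qed

lemma Tr_S_omega: "\<omega> ** mat (Tr_q q S) = - (mat (Tr_q q S) ** \<omega>)"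
proof -
  have "leg2 \<omega> ** Rhat_inv q ** leg2 S ** Rhat q = - (Rhat q ** leg2 S ** Rhat_inv q ** leg2 \<omega>)"
    using hecke.w_S_conj by (simp add: leg2_S)
  from arg_cong[OF this, of "Tr_q1 q"] show ?thesis
    by (simp add: Tr_q1_linear Tr_q1_leg2_conj Tr_q1_leg2_mult(2) Tr_q1_Rhat_conj q_nonzero)
qed

lemma omega_reflection:
  "leg2 \<omega> ** Rhat_inv q ** leg2 \<omega> =
    - (Rhat q ** leg2 \<omega> ** Rhat_inv q ** leg2 \<omega> ** Rhat q)"
proof -
  have "Rhat q ** leg2 \<omega> ** Rhat_inv q ** leg2 \<omega> = - (leg2 \<omega> ** Rhat_inv q ** leg2 \<omega> ** Rhat_inv q)"
    using hecke.w_w_conj by simp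
  then have "Rhat q ** leg2 \<omega> ** Rhat_inv q ** leg2 \<omega> ** Rhat q =
      - (leg2 \<omega> ** Rhat_inv q ** leg2 \<omega> ** (Rhat_inv q ** Rhat q))"
    by (simp add: matrix_distribs matrix_mul_assoc)
  then show ?thesis by (simp add: Rhat_inverse(2) q_nonzero)
qed

lemma S_reflection:
  "leg2 S ** Rhat_inv q ** leg2 S = - (Rhat q ** leg2 S ** Rhat_inv q ** leg2 S ** Rhat q)"
  using hecke.S_S by (simp add: leg2_S)

lemma Tr_omega_T: "mat (Tr_q q \<omega>) ** T = T ** (mat (Tr_q q \<omega>) - mscale (lam q) \<omega>)"
  using arg_cong[OF omega_T, of "Tr_q1 q"]
  by (simp add: Tr_q1_leg2_mult(2) Tr_q1_leg1 Tr_q1_leg2_conj q_nonzero)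

text \<open>The partial trace of R' S R is scalar without correction, so only \<omega> contributes
  to [Q, T].\<close>

lemma Tr_S_T: "mat (Tr_q q S) ** T = T ** mat (Tr_q q S)"
proof -
  have "Ring_Of (leg1 \<omega>) * Ring_Of (leg1 L) * Ring_Of (leg1 (matrix_inv K)) * Ring_Of (leg2 T) =
      Ring_Of (leg2 T) * Ring_Of (Rhat_inv q) * hecke.S * Ring_Of (Rhat q)"
    by (rule hecke.S_intertwine[where ?J1.0 = "Ring_Of (leg1 J)" and ?K1.0 = "Ring_Of (leg1 K)"])
      (simp_all add: omega_T J_T L_T leg_K_inverse, simp add: leg1_K Ring_Of_mat_1 del:
        Ring_Of_simps(5,6))
  then have "leg1 S ** leg2 T = leg2 T ** Rhat_inv q ** leg2 S ** Rhat q"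
    by (simp add: leg1_hom leg2_S)
  from arg_cong[OF this, of "Tr_q1 q"] show ?thesis
    by (simp add: Tr_q1_leg2_mult(2) Tr_q1_leg1 Tr_q1_leg2_conj q_nonzero)
qed

lemma mscale_lam: "mscale (1 / lam q) (mscale (lam q) A) = A"
  by (simp add: mscale_def vec_eq_iff scaleC_scaleC lam_nonzero scaleC_one)

text \<open>Since \<lambda> \<omega> J = K - 1, the second term of \<open>BRST\<close> is (\<omega>
  L - S) / \<lambda>, and \<omega> L cancels against the first.\<close>

lemma BRST_eq: "BRST q \<omega> L J = (1 / lam q) *\<^sub>C (Tr_q q S - Tr_q q \<omega>)"
proof -
  have "mscale (lam q) (\<omega> ** L ** (\<omega> ** J) ** matrix_inv K) =
      \<omega> ** L ** mscale (lam q) (\<omega> ** J) ** matrix_inv K"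
    by (simp add: mscale_mult)
  also have "mscale (lam q) (\<omega> ** J) = K - mat 1"
    by (simp add: K_mat_def)
  also have "\<omega> ** L ** (K - mat 1) ** matrix_inv K = \<omega> ** L ** (K ** matrix_inv K) - S"
    by (simp add: matrix_distribs matrix_mul_assoc)
  also have "\<dots> = \<omega> ** L - S"
    by (simp add: matrix_inv K_invertible)
  finally have "mscale (1 / lam q) (mscale (lam q) (\<omega> ** L ** (\<omega> ** J) ** matrix_inv K)) =
      mscale (1 / lam q) (\<omega> ** L - S)"
    by simp
  then show ?thesis
    by (simp add: BRST_def mscale_lam Tr_q_linear mscale_mult matrix_distribs
        scaleC.scale_right_diff_distrib)
qed

lemma mat_BRST:
  "mat (BRST q \<omega> L J) = mscale (1 / lam q) (mat (Tr_q q S) - mat (Tr_q q \<omega>))"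
  by (simp add: BRST_eq mat_def mscale_def vec_eq_iff)

lemma BRST_square:
  assumes "q\<^sup>2 \<noteq> - 1"
  shows "(BRST q \<omega> L J)\<^sup>2 = 0"
proof -
  have "Tr_q q \<omega> * Tr_q q S = - (Tr_q q S * Tr_q q \<omega>)"
    using arg_cong[OF Tr_S_omega, of "Tr_q q"] by (simp add: Tr_q_linear)
  then show ?thesis
    by (simp add: BRST_eq power2_eq_square mult_scaleC_left mult_scaleC_right algebra_simps
        Tr_q_square_eq_0[OF q_nonzero assms omega_reflection]
        Tr_q_square_eq_0[OF q_nonzero assms S_reflection])
qed

lemma comm_BRST:
  "comm (BRST q \<omega> L J) A = mscale (1 / lam q)
    ((mat (Tr_q q S) ** A - A ** mat (Tr_q q S)) - (mat (Tr_q q \<omega>) ** A - A ** mat (Tr_q q \<omega>)))"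
  and anticomm_BRST:
  "anticomm (BRST q \<omega> L J) A = mscale (1 / lam q)
    ((mat (Tr_q q S) ** A + A ** mat (Tr_q q S)) - (mat (Tr_q q \<omega>) ** A + A ** mat (Tr_q q \<omega>)))"
  for A :: "('a, 'n) sqmat"
  unfolding comm_eq anticomm_eq mat_BRST mscale_mult matrix_distribs
  by (simp_all add: mscale_def vec_eq_iff scaleC_add_right scaleC.scale_right_diff_distrib)

end

theorem mainTheorem3:
  fixes q :: complex
    and T \<omega> L J :: "('a::complex_algebra_1, 'n::{finite,linorder}) sqmat"
  assumes "glq_differential_algebra q T \<omega> L J"
  shows "BRST q \<omega> L J
        = - ((1 / lam q) *\<^sub>C Tr_q q \<omega>)
          + (1 / lam q) *\<^sub>C Tr_q q (\<omega> ** L ** matrix_inv (K_mat q \<omega> J))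
    \<and> (q^2 \<noteq> -1 \<longrightarrow> (BRST q \<omega> L J)^2 = 0)
    \<and> comm (BRST q \<omega> L J) L = 0
    \<and> comm (BRST q \<omega> L J) T = T ** \<omega>
    \<and> anticomm (BRST q \<omega> L J) \<omega> = - (\<omega> ** \<omega>)
    \<and> anticomm (BRST q \<omega> L J) J = mscale (1 / lam q) (mat 1 - L)"
proof -
  interpret glq_differential_algebra q T \<omega> L J by (rule assms)
  have minus: "mscale (1 / lam q) (- mscale (lam q) A) = - A" for A :: "('a, 'n) sqmat"
    using mscale_lam[of A] by (simp add: mscale_def vec_eq_iff)
  have "comm (BRST q \<omega> L J) L = 0"
    by (simp add: comm_BRST Tr_omega_L Tr_S_L) (simp add: mscale_def vec_eq_iff)
  moreover have "comm (BRST q \<omega> L J) T = T ** \<omega>"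
    by (simp add: comm_BRST Tr_omega_T Tr_S_T matrix_distribs mscale_mult mscale_lam)
  moreover have "anticomm (BRST q \<omega> L J) \<omega> = - (\<omega> ** \<omega>)"
    \<comment> \<open>The trace of \<open>S\<close> anticommutes with \<omega>, and the trace of
      \<omega> gives \<lambda> \<omega>^2, which enters with a minus sign.\<close>
    unfolding anticomm_BRST Tr_S_omega Tr_q_anticommute[OF q_nonzero omega_reflection]
    by (simp add: minus)
  moreover have "anticomm (BRST q \<omega> L J) J = mscale (1 / lam q) (mat 1 - L)"
    unfolding anticomm_BRST Tr_S_J Tr_omega_J by simp
  ultimately show ?thesis
    using BRST_square by (simp add: BRST_eq scaleC.scale_right_diff_distrib)
qed

end
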